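(* Let $R\bowtie^{f}J$ be the amalgamation of commutative semirings $R$ and $R'$ along the ideal $J$ of $R'$ with respect to a semiring homomorphism $f:R\to R'$. Let $S$ be a multiplicatively closed subset of $R$, let $I$ be an ideal of $R$ such that $I\cap S=\emptyset$, and suppose $J\subseteq N(R')$. Then the following assertions are equivalent: (i) $I\bowtie^{f}J$ is a quasi $S'$-$n$-ideal of $R\bowtie^{f}J$; (ii) $I\bowtie^{f}J$ is a quasi $(S\bowtie^{f}J)$-$n$-ideal of $R\bowtie^{f}J$; (iii) $I$ is a quasi $S$-$n$-ideal of $R$.
   Context: All semirings are commutative with identity $1\neq 0$. A subset $S$ of a semiring is multiplicatively closed if $0\notin S$, $1\in S$, and $st\in S$ for all $s,t\in S$. $N(R)$ denotes the nilradical (set of nilpotent elements) of a semiring $R$. A proper ideal $I$ of $R$ with $I\cap S=\emptyset$ is a quasi $S$-$n$-ideal of $R$ if there exists a fixed element $s\in S$ such that, for all $a,b\in R$, $ab\in I$ implies $sa^2\in I$ or $sb\in N(R)$. For a semiring homomorphism $f:R\to R'$ and an ideal $J$ of $R'$, the amalgamation is the subsemiring $R\bowtie^{f}J=\{(a,f(a)+j): a\in R, j\in J\}$ of $R\times R'$. For an ideal $I$ of $R$, $I\bowtie^{f}J=\{(i,f(i)+j): i\in I, j\in J\}$, an ideal of $R\bowtie^{f}J$. For a multiplicatively closed $S\subseteq R$, the sets $S\bowtie^{f}J=\{(s,f(s)+j): s\in S, j\in J\}$ and $S'=\{(s,f(s)): s\in S\}$ are multiplicatively closed subsets of $R\bowtie^{f}J$.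 *)

theory Defs
  imports "HOL-Algebra.Chinese_Remainder"
begin

locale csemiring = semiring R + comm_monoid R for R (structure) +
  assumes one_not_zero: "\<one> \<noteq> \<zero>"

text \<open>\<^const>\<open>ring_hom\<close> does not mention zero, which a semiring homomorphism has to preserve as well.\<close>

definition semiring_hom :: "('a, 'm) ring_scheme \<Rightarrow> ('b, 'n) ring_scheme \<Rightarrow> ('a \<Rightarrow> 'b) set" where
  "semiring_hom R R' = {f \<in> ring_hom R R'. f \<zero>\<^bsub>R\<^esub> = \<zero>\<^bsub>R'\<^esub>}"

text \<open>The library locale \<^locale>\<open>ideal\<close> requires a ring, so ideals of a semiring are defined here.\<close>

definition semiring_ideal :: "'a set \<Rightarrow> ('a, 'm) ring_scheme \<Rightarrow> bool" where
  "semiring_ideal I R \<longleftrightarrow>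
     I \<subseteq> carrier R \<and> I \<noteq> {} \<and>
     (\<forall>x\<in>I. \<forall>y\<in>I. x \<oplus>\<^bsub>R\<^esub> y \<in> I) \<and>
     (\<forall>r\<in>carrier R. \<forall>x\<in>I. r \<otimes>\<^bsub>R\<^esub> x \<in> I \<and> x \<otimes>\<^bsub>R\<^esub> r \<in> I)"

definition nilradical :: "('a, 'm) ring_scheme \<Rightarrow> 'a set" where
  "nilradical R = {x \<in> carrier R. \<exists>n::nat. n \<ge> 1 \<and> x [^]\<^bsub>R\<^esub> n = \<zero>\<^bsub>R\<^esub>}"

definition mult_closed :: "'a set \<Rightarrow> ('a, 'm) ring_scheme \<Rightarrow> bool" where
  "mult_closed S R \<longleftrightarrow> submonoid S R \<and> \<zero>\<^bsub>R\<^esub> \<notin> S"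

text \<open>The notion is only meaningful for a multiplicatively closed \<open>S\<close> and an ideal \<open>I\<close>;
  both requirements are included in the predicate.\<close>

definition quasi_S_n_ideal :: "'a set \<Rightarrow> 'a set \<Rightarrow> ('a, 'm) ring_scheme \<Rightarrow> bool" where
  "quasi_S_n_ideal S I R \<longleftrightarrow>
     mult_closed S R \<and> semiring_ideal I R \<and> I \<noteq> carrier R \<and> I \<inter> S = {} \<and>
     (\<exists>s\<in>S. \<forall>a\<in>carrier R. \<forall>b\<in>carrier R. a \<otimes>\<^bsub>R\<^esub> b \<in> I \<longrightarrow>
        s \<otimes>\<^bsub>R\<^esub> (a [^]\<^bsub>R\<^esub> (2::nat)) \<in> I \<or> s \<otimes>\<^bsub>R\<^esub> b \<in> nilradical R)"

text \<open>\<open>amalg_set R' f A J\<close> is \<open>A \<bowtie>\<^sup>f J\<close>, used for \<open>A\<close> the whole semiring, an ideal, or a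
  multiplicatively closed set.\<close>

definition amalg_set :: "('b, 'n) ring_scheme \<Rightarrow> ('a \<Rightarrow> 'b) \<Rightarrow> 'a set \<Rightarrow> 'b set \<Rightarrow> ('a \<times> 'b) set" where
  "amalg_set R' f A J = {(a, f a \<oplus>\<^bsub>R'\<^esub> j) | a j. a \<in> A \<and> j \<in> J}"

definition amalgamation ::
  "('a, 'm) ring_scheme \<Rightarrow> ('b, 'n) ring_scheme \<Rightarrow> ('a \<Rightarrow> 'b) \<Rightarrow> 'b set \<Rightarrow> ('a \<times> 'b) ring" where
  "amalgamation R R' f J = (RDirProd R R')\<lparr>carrier := amalg_set R' f (carrier R) J\<rparr>"

definition graph_set :: "('a \<Rightarrow> 'b) \<Rightarrow> 'a set \<Rightarrow> ('a \<times> 'b) set" where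
  "graph_set f S = {(s, f s) | s. s \<in> S}"

end

theory Submission
  imports Defs
begin

text \<open>Since \<open>J\<close> consists of nilpotents, the projection \<open>R \<bowtie>\<^sup>f J \<rightarrow> R\<close> onto the first component
  sees everything that the definition of a quasi \<open>S\<close>-\<open>n\<close>-ideal speaks of: it is surjective and
  multiplicative, \<open>I \<bowtie>\<^sup>f J\<close> is the full preimage of \<open>I\<close>, and the nilradical of \<open>R \<bowtie>\<^sup>f J\<close> is the
  full preimage of \<open>N(R)\<close> (lemma \<open>nilradical_iff\<close>). Hence the element \<open>t\<close> witnesses the condition
  for \<open>I \<bowtie>\<^sup>f J\<close> iff its first component witnesses it for \<open>I\<close>. So for a multiplicatively closed set
  \<open>T\<close> of the amalgamation, being a quasi \<open>T\<close>-\<open>n\<close>-ideal depends only on the projection of \<open>T\<close> to \<open>R\<close>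
  (lemma \<open>quasi_iff_fst_image\<close>). Both \<open>S'\<close> and \<open>S \<bowtie>\<^sup>f J\<close> project onto \<open>S\<close>, so both conditions
  on \<open>I \<bowtie>\<^sup>f J\<close> are equivalent to the one on \<open>I\<close>.\<close>

section \<open>Nilpotents and ideals of a commutative semiring\<close>

lemma (in csemiring) mem_nilradical_if_pow_mem:
  assumes "x \<in> carrier R" "x [^] (n::nat) \<in> nilradical R" "n \<ge> 1"
  shows "x \<in> nilradical R"
proof -
  obtain m :: nat where "m \<ge> 1" "(x [^] n) [^] m = \<zero>"
    using assms(2) by (auto simp: nilradical_def)
  then have "n * m \<ge> 1" "x [^] (n * m) = \<zero>"
    using assms by (simp_all add: nat_pow_pow)
  then show ?thesis
    using assms(1) unfolding nilradical_def by blast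
qed

lemma (in csemiring) zero_mem_semiring_ideal:
  assumes "semiring_ideal I R"
  shows "\<zero> \<in> I"
proof -
  obtain x where "x \<in> I" "x \<in> carrier R"
    using assms by (auto simp: semiring_ideal_def)
  then have "\<zero> \<otimes> x \<in> I"
    using assms zero_closed unfolding semiring_ideal_def by blast
  then show ?thesis
    using \<open>x \<in> carrier R\<close> by simp
qed

text \<open>Congruence modulo \<open>J\<close> is multiplicative: this replaces, in the absence of negatives and
  quotients, the computation in \<open>R/J\<close>.\<close>

lemma (in csemiring) mult_perturbed:
  assumes J: "semiring_ideal J R" and "a \<in> carrier R" "b \<in> carrier R" "j \<in> J" "k \<in> J"
  shows "\<exists>l\<in>J. (a \<oplus> j) \<otimes> (b \<oplus> k) = a \<otimes> b \<oplus> l"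
proof
  have c: "j \<in> carrier R" "k \<in> carrier R"
    using assms by (auto simp: semiring_ideal_def)
  show "a \<otimes> k \<oplus> (j \<otimes> b \<oplus> j \<otimes> k) \<in> J"
    using assms c by (simp add: semiring_ideal_def)
  show "(a \<oplus> j) \<otimes> (b \<oplus> k) = a \<otimes> b \<oplus> (a \<otimes> k \<oplus> (j \<otimes> b \<oplus> j \<otimes> k))"
    using assms(2,3) c by (simp add: l_distr r_distr add.m_ac)
qed

lemma (in csemiring) pow_perturbed:
  assumes J: "semiring_ideal J R" and "a \<in> carrier R" "j \<in> J"
  shows "\<exists>l\<in>J. (a \<oplus> j) [^] (n::nat) = a [^] n \<oplus> l"
proof (induction n)
  case 0
  show ?case
    using zero_mem_semiring_ideal[OF J] by (auto intro!: bexI[of _ \<zero>])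
next
  case (Suc n)
  then show ?case
    using mult_perturbed[OF J _ assms(2) _ assms(3), of "a [^] n"] assms(2) by auto
qed

section \<open>The amalgamation and its first projection\<close>

lemma amalg_set_iff:
  "z \<in> amalg_set R' f A J \<longleftrightarrow> fst z \<in> A \<and> (\<exists>j\<in>J. snd z = f (fst z) \<oplus>\<^bsub>R'\<^esub> j)"
  by (cases z) (auto simp: amalg_set_def)

lemma amalgamation_simps:
  "carrier (amalgamation R R' f J) = amalg_set R' f (carrier R) J"
  "z \<otimes>\<^bsub>amalgamation R R' f J\<^esub> w = (fst z \<otimes>\<^bsub>R\<^esub> fst w, snd z \<otimes>\<^bsub>R'\<^esub> snd w)"
  "z \<oplus>\<^bsub>amalgamation R R' f J\<^esub> w = (fst z \<oplus>\<^bsub>R\<^esub> fst w, snd z \<oplus>\<^bsub>R'\<^esub> snd w)"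
  "\<one>\<^bsub>amalgamation R R' f J\<^esub> = (\<one>\<^bsub>R\<^esub>, \<one>\<^bsub>R'\<^esub>)"
  "\<zero>\<^bsub>amalgamation R R' f J\<^esub> = (\<zero>\<^bsub>R\<^esub>, \<zero>\<^bsub>R'\<^esub>)"
  by (cases z; cases w;
      simp add: amalgamation_def RDirProd_def DirProd_def monoid.defs ring.defs)+

lemma amalgamation_pow:
  "z [^]\<^bsub>amalgamation R R' f J\<^esub> (n::nat) = (fst z [^]\<^bsub>R\<^esub> n, snd z [^]\<^bsub>R'\<^esub> n)"
  by (induction n) (simp_all add: nat_pow_def amalgamation_simps)

locale semiring_amalgamation = csemiring R + R': csemiring R'
  for R :: "('a, 'm) ring_scheme" (structure) and R' :: "('b, 'n) ring_scheme" +
  fixes f :: "'a \<Rightarrow> 'b" and J :: "'b set"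
  assumes f_hom: "f \<in> semiring_hom R R'"
    and J_ideal: "semiring_ideal J R'"
begin

abbreviation "A \<equiv> amalgamation R R' f J"

lemma f_closed: "a \<in> carrier R \<Longrightarrow> f a \<in> carrier R'"
  and f_mult: "a \<in> carrier R \<Longrightarrow> b \<in> carrier R \<Longrightarrow> f (a \<otimes> b) = f a \<otimes>\<^bsub>R'\<^esub> f b"
  and f_add: "a \<in> carrier R \<Longrightarrow> b \<in> carrier R \<Longrightarrow> f (a \<oplus> b) = f a \<oplus>\<^bsub>R'\<^esub> f b"
  and f_one: "f \<one> = \<one>\<^bsub>R'\<^esub>"
  and f_zero: "f \<zero> = \<zero>\<^bsub>R'\<^esub>"
  using f_hom by (auto simp: semiring_hom_def ring_hom_def)

lemma f_pow: "a \<in> carrier R \<Longrightarrow> f (a [^] (n::nat)) = f a [^]\<^bsub>R'\<^esub> n"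
  by (induction n) (simp_all add: f_one f_mult)

lemma J_carrier: "j \<in> J \<Longrightarrow> j \<in> carrier R'"
  and J_add: "j \<in> J \<Longrightarrow> k \<in> J \<Longrightarrow> j \<oplus>\<^bsub>R'\<^esub> k \<in> J"
  using J_ideal by (auto simp: semiring_ideal_def)

lemma zero_mem_J: "\<zero>\<^bsub>R'\<^esub> \<in> J"
  by (rule R'.zero_mem_semiring_ideal[OF J_ideal])

lemma graph_mem_amalg_set:
  assumes "a \<in> B" "a \<in> carrier R"
  shows "(a, f a) \<in> amalg_set R' f B J"
  using assms zero_mem_J by (auto simp: amalg_set_iff f_closed intro!: bexI[of _ "\<zero>\<^bsub>R'\<^esub>"])

lemma fst_amalg_set:
  assumes "B \<subseteq> carrier R"
  shows "fst ` amalg_set R' f B J = B"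
proof
  show "B \<subseteq> fst ` amalg_set R' f B J"
    using assms graph_mem_amalg_set by force
qed (auto simp: amalg_set_iff)

lemma amalg_set_preimage:
  assumes "z \<in> carrier A"
  shows "z \<in> amalg_set R' f B J \<longleftrightarrow> fst z \<in> B"
  using assms by (auto simp: amalg_set_iff amalgamation_simps)

lemma mult_closed_A:
  assumes "z \<in> carrier A" "w \<in> carrier A"
  shows "z \<otimes>\<^bsub>A\<^esub> w \<in> carrier A"
proof -
  obtain j k where jk: "j \<in> J" "k \<in> J" "snd z = f (fst z) \<oplus>\<^bsub>R'\<^esub> j" "snd w = f (fst w) \<oplus>\<^bsub>R'\<^esub> k"
    and c: "fst z \<in> carrier R" "fst w \<in> carrier R"
    using assms by (auto simp: amalg_set_iff amalgamation_simps)
  then show ?thesis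
    using R'.mult_perturbed[OF J_ideal f_closed[OF c(1)] f_closed[OF c(2)] jk(1,2)]
    by (simp add: amalg_set_iff amalgamation_simps f_mult)
qed

lemma add_closed_A:
  assumes "z \<in> carrier A" "w \<in> carrier A"
  shows "z \<oplus>\<^bsub>A\<^esub> w \<in> carrier A"
proof -
  obtain j k where jk: "j \<in> J" "k \<in> J" "snd z = f (fst z) \<oplus>\<^bsub>R'\<^esub> j" "snd w = f (fst w) \<oplus>\<^bsub>R'\<^esub> k"
    and c: "fst z \<in> carrier R" "fst w \<in> carrier R"
    using assms by (auto simp: amalg_set_iff amalgamation_simps)
  then have "snd z \<oplus>\<^bsub>R'\<^esub> snd w = f (fst z \<oplus> fst w) \<oplus>\<^bsub>R'\<^esub> (j \<oplus>\<^bsub>R'\<^esub> k)"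
    by (simp add: f_add f_closed J_carrier R'.add.m_ac)
  then show ?thesis
    using jk c J_add by (auto simp: amalg_set_iff amalgamation_simps)
qed

lemma one_mem_A: "\<one>\<^bsub>A\<^esub> \<in> carrier A"
  using graph_mem_amalg_set[of \<one> "carrier R"] by (simp add: amalgamation_simps f_one)

lemma amalg_set_semiring_ideal:
  assumes I: "semiring_ideal I R"
  shows "semiring_ideal (amalg_set R' f I J) A"
proof -
  have sub: "amalg_set R' f I J \<subseteq> carrier A"
    using I by (auto simp: amalg_set_iff amalgamation_simps semiring_ideal_def)
  have "(\<zero>, f \<zero>) \<in> amalg_set R' f I J"
    by (intro graph_mem_amalg_set zero_mem_semiring_ideal I zero_closed)
  moreover have "x \<oplus>\<^bsub>A\<^esub> y \<in> amalg_set R' f I J"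
    if "x \<in> amalg_set R' f I J" "y \<in> amalg_set R' f I J" for x y
  proof -
    have "fst x \<in> I" "fst y \<in> I" "x \<in> carrier A" "y \<in> carrier A"
      using that sub by (meson amalg_set_iff subsetD)+
    then show ?thesis
      using I amalg_set_preimage[OF add_closed_A]
      by (simp add: amalgamation_simps(3) semiring_ideal_def)
  qed
  moreover have "r \<otimes>\<^bsub>A\<^esub> x \<in> amalg_set R' f I J" "x \<otimes>\<^bsub>A\<^esub> r \<in> amalg_set R' f I J"
    if r: "r \<in> carrier A" and x: "x \<in> amalg_set R' f I J" for r x
  proof -
    have "fst r \<in> carrier R" "fst x \<in> I" "x \<in> carrier A"
      using r x sub by (metis amalgamation_simps(1) amalg_set_iff subsetD)+
    then show "r \<otimes>\<^bsub>A\<^esub> x \<in> amalg_set R' f I J" "x \<otimes>\<^bsub>A\<^esub> r \<in> amalg_set R' f I J"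
      using I r amalg_set_preimage[OF mult_closed_A]
      by (simp_all add: amalgamation_simps(2) semiring_ideal_def)
  qed
  ultimately show ?thesis
    using sub unfolding semiring_ideal_def by blast
qed

lemma amalg_set_mult_closed:
  assumes S: "mult_closed S R"
  shows "mult_closed (amalg_set R' f S J) A"
proof -
  have S': "S \<subseteq> carrier R" "\<one> \<in> S" "\<zero> \<notin> S" "\<And>s t. s \<in> S \<Longrightarrow> t \<in> S \<Longrightarrow> s \<otimes> t \<in> S"
    using S by (auto simp: mult_closed_def submonoid_def)
  have sub: "amalg_set R' f S J \<subseteq> carrier A"
    using S' by (auto simp: amalg_set_iff amalgamation_simps)
  have "submonoid (amalg_set R' f S J) A"
  proof
    show "\<one>\<^bsub>A\<^esub> \<in> amalg_set R' f S J"
      using amalg_set_preimage[OF one_mem_A] S' by (simp add: amalgamation_simps)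
    show "x \<otimes>\<^bsub>A\<^esub> y \<in> amalg_set R' f S J"
      if "x \<in> amalg_set R' f S J" "y \<in> amalg_set R' f S J" for x y
    proof -
      have "fst x \<in> S" "fst y \<in> S" "x \<in> carrier A" "y \<in> carrier A"
        using that sub by (meson amalg_set_iff subsetD)+
      then show ?thesis
        using S'(4) amalg_set_preimage[OF mult_closed_A] by (simp add: amalgamation_simps(2))
    qed
  qed (rule sub)
  then show ?thesis
    using S' by (simp add: mult_closed_def amalg_set_iff amalgamation_simps)
qed

lemma graph_set_mult_closed:
  assumes S: "mult_closed S R"
  shows "mult_closed (graph_set f S) A"
proof -
  have S': "S \<subseteq> carrier R" "\<one> \<in> S" "\<zero> \<notin> S" "\<And>s t. s \<in> S \<Longrightarrow> t \<in> S \<Longrightarrow> s \<otimes> t \<in> S"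
    using S by (auto simp: mult_closed_def submonoid_def)
  have "submonoid (graph_set f S) A"
  proof
    show "graph_set f S \<subseteq> carrier A"
      using S' by (auto simp: graph_set_def amalgamation_simps intro!: graph_mem_amalg_set)
    show "\<one>\<^bsub>A\<^esub> \<in> graph_set f S"
      using S' by (auto simp: graph_set_def amalgamation_simps f_one)
    show "x \<otimes>\<^bsub>A\<^esub> y \<in> graph_set f S" if "x \<in> graph_set f S" "y \<in> graph_set f S" for x y
      using that S'(1,4) by (auto simp: graph_set_def amalgamation_simps f_mult subset_iff)
  qed
  then show ?thesis
    using S' by (auto simp: mult_closed_def graph_set_def amalgamation_simps)
qed

section \<open>Transfer along the first projection\<close>

text \<open>If \<open>a\<^sup>n = 0\<close> then \<open>(f a + j)\<^sup>n\<close> lies in \<open>J\<close> because it differs from \<open>f (a\<^sup>n) = 0\<close> by an element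
  of \<open>J\<close>; so it is nilpotent, and hence so is \<open>f a + j\<close>. This avoids the binomial formula.\<close>

lemma nilradical_iff:
  assumes nil: "J \<subseteq> nilradical R'" and z: "z \<in> carrier A"
  shows "z \<in> nilradical A \<longleftrightarrow> fst z \<in> nilradical R"
proof
  assume "z \<in> nilradical A"
  then show "fst z \<in> nilradical R"
    using z by (auto simp: nilradical_def amalgamation_simps amalgamation_pow amalg_set_iff)
next
  assume "fst z \<in> nilradical R"
  then obtain n :: nat where n: "n \<ge> 1" "fst z [^] n = \<zero>" and c: "fst z \<in> carrier R"
    by (auto simp: nilradical_def)
  obtain j where j: "j \<in> J" "snd z = f (fst z) \<oplus>\<^bsub>R'\<^esub> j"
    using z by (auto simp: amalgamation_simps amalg_set_iff)
  obtain l where "l \<in> J" "snd z [^]\<^bsub>R'\<^esub> n = f (fst z) [^]\<^bsub>R'\<^esub> n \<oplus>\<^bsub>R'\<^esub> l"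
    using R'.pow_perturbed[OF J_ideal f_closed[OF c] j(1), of n] j(2) by auto
  moreover have "f (fst z) [^]\<^bsub>R'\<^esub> n = \<zero>\<^bsub>R'\<^esub>"
    using f_pow[OF c, of n] n f_zero by simp
  ultimately have "snd z [^]\<^bsub>R'\<^esub> n \<in> nilradical R'"
    using nil J_carrier by auto
  moreover have sc: "snd z \<in> carrier R'"
    using j c f_closed J_carrier by simp
  ultimately obtain m :: nat where m: "m \<ge> 1" "snd z [^]\<^bsub>R'\<^esub> m = \<zero>\<^bsub>R'\<^esub>"
    using R'.mem_nilradical_if_pow_mem[OF _ _ n(1)] by (auto simp: nilradical_def)
  \<comment> \<open>The two components vanish at different exponents; the product of these serves both.\<close>
  have "fst z [^] (n * m) = (fst z [^] n) [^] m"
    using c by (simp add: nat_pow_pow)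
  also have "\<dots> = \<zero>"
    using n m by (simp add: nat_pow_zero)
  finally have "fst z [^] (n * m) = \<zero>" .
  moreover have "snd z [^]\<^bsub>R'\<^esub> (n * m) = (snd z [^]\<^bsub>R'\<^esub> m) [^]\<^bsub>R'\<^esub> n"
    using sc by (simp add: R'.nat_pow_pow mult.commute)
  then have "snd z [^]\<^bsub>R'\<^esub> (n * m) = \<zero>\<^bsub>R'\<^esub>"
    using n m by (simp add: R'.nat_pow_zero)
  moreover have "n * m \<ge> 1"
    using n m by simp
  ultimately show "z \<in> nilradical A"
    using z unfolding nilradical_def amalgamation_pow amalgamation_simps(5) by blast
qed

text \<open>All conditions in the definition are pulled back along the first projection, and every
  element of \<open>R\<close> lifts to the amalgamation, for instance as \<open>(a, f a)\<close>.\<close>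

lemma quasi_iff_fst_image:
  assumes nil: "J \<subseteq> nilradical R'" and I: "semiring_ideal I R"
    and T: "mult_closed T A" and S: "mult_closed (fst ` T) R"
  shows "quasi_S_n_ideal T (amalg_set R' f I J) A \<longleftrightarrow> quasi_S_n_ideal (fst ` T) I R"
proof -
  let ?K = "amalg_set R' f I J"
  have TA: "T \<subseteq> carrier A"
    using T by (simp add: mult_closed_def submonoid_def)
  have IR: "I \<subseteq> carrier R"
    using I by (simp add: semiring_ideal_def)
  have proj: "fst ` carrier A = carrier R"
    by (simp add: amalgamation_simps fst_amalg_set)
  have proper: "?K \<noteq> carrier A \<longleftrightarrow> I \<noteq> carrier R"
    by (metis IR amalgamation_simps(1) fst_amalg_set proj)
  have disj: "?K \<inter> T = {} \<longleftrightarrow> I \<inter> fst ` T = {}"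
    using TA amalg_set_preimage by blast
  have witness: "(\<forall>z\<in>carrier A. \<forall>w\<in>carrier A. z \<otimes>\<^bsub>A\<^esub> w \<in> ?K \<longrightarrow>
        t \<otimes>\<^bsub>A\<^esub> (z [^]\<^bsub>A\<^esub> (2::nat)) \<in> ?K \<or> t \<otimes>\<^bsub>A\<^esub> w \<in> nilradical A) \<longleftrightarrow>
      (\<forall>a\<in>carrier R. \<forall>b\<in>carrier R. a \<otimes> b \<in> I \<longrightarrow>
        fst t \<otimes> (a [^] (2::nat)) \<in> I \<or> fst t \<otimes> b \<in> nilradical R)"
    (is "?lhs \<longleftrightarrow> ?rhs") if t: "t \<in> T" for t
  proof -
    have "(z \<otimes>\<^bsub>A\<^esub> w \<in> ?K \<longrightarrow> t \<otimes>\<^bsub>A\<^esub> (z [^]\<^bsub>A\<^esub> (2::nat)) \<in> ?K \<or> t \<otimes>\<^bsub>A\<^esub> w \<in> nilradical A) \<longleftrightarrow>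
        (fst z \<otimes> fst w \<in> I \<longrightarrow>
          fst t \<otimes> (fst z [^] (2::nat)) \<in> I \<or> fst t \<otimes> fst w \<in> nilradical R)"
      if z: "z \<in> carrier A" and w: "w \<in> carrier A" for z w
    proof -
      have tA: "t \<in> carrier A"
        using t TA by blast
      have "z [^]\<^bsub>A\<^esub> (2::nat) = \<one>\<^bsub>A\<^esub> \<otimes>\<^bsub>A\<^esub> z \<otimes>\<^bsub>A\<^esub> z"
        by (simp add: numeral_2_eq_2 nat_pow_def)
      then have z2: "z [^]\<^bsub>A\<^esub> (2::nat) \<in> carrier A"
        by (simp only:) (intro mult_closed_A one_mem_A z)
      then show ?thesis
        using amalg_set_preimage[OF mult_closed_A[OF z w]]
          amalg_set_preimage[OF mult_closed_A[OF tA z2]] nilradical_iff[OF nil mult_closed_A[OF tA w]]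
        by (simp add: amalgamation_simps(2) amalgamation_pow)
    qed
    then have "?lhs \<longleftrightarrow> (\<forall>z\<in>carrier A. \<forall>w\<in>carrier A. fst z \<otimes> fst w \<in> I \<longrightarrow>
        fst t \<otimes> (fst z [^] (2::nat)) \<in> I \<or> fst t \<otimes> fst w \<in> nilradical R)"
      by blast
    also have "\<dots> \<longleftrightarrow> ?rhs"
      unfolding proj[symmetric] by blast
    finally show ?thesis .
  qed
  show ?thesis
    unfolding quasi_S_n_ideal_def
    using T S I amalg_set_semiring_ideal[OF I] proper disj witness by simp
qed

end

theorem theorem3p5:
  fixes R :: "('a, 'm) ring_scheme" and R' :: "('b, 'n) ring_scheme"
    and f :: "'a \<Rightarrow> 'b" and J :: "'b set" and S I :: "'a set"
  assumes "csemiring R" and "csemiring R'"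
    and "f \<in> semiring_hom R R'"
    and "semiring_ideal J R'"
    and "mult_closed S R"
    and "semiring_ideal I R"
    and "I \<inter> S = {}"
    and "J \<subseteq> nilradical R'"
  shows "(quasi_S_n_ideal (graph_set f S) (amalg_set R' f I J) (amalgamation R R' f J)
            \<longleftrightarrow> quasi_S_n_ideal (amalg_set R' f S J) (amalg_set R' f I J) (amalgamation R R' f J))
       \<and> (quasi_S_n_ideal (amalg_set R' f S J) (amalg_set R' f I J) (amalgamation R R' f J)
            \<longleftrightarrow> quasi_S_n_ideal S I R)"
proof -
  interpret semiring_amalgamation R R' f J
    using assms(1-4) by (simp add: semiring_amalgamation_def semiring_amalgamation_axioms_def)
  have "S \<subseteq> carrier R"
    using assms(5) by (simp add: mult_closed_def submonoid_def)
  then have "fst ` amalg_set R' f S J = S"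
    by (rule fst_amalg_set)
  moreover have "fst ` graph_set f S = S"
    by (force simp: graph_set_def)
  ultimately show ?thesis
    using quasi_iff_fst_image[OF assms(8,6) graph_set_mult_closed[OF assms(5)]]
      quasi_iff_fst_image[OF assms(8,6) amalg_set_mult_closed[OF assms(5)]] assms(5)
    by simp
qed

end
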